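(* Let $\Gamma$ be a simple strongly connected digraph with vertex set $X$, adjacency matrix $A$, diameter $D$ and distance-$i$ matrices $A_0=I,A_1=A,\ldots,A_D$. Then $\Gamma$ is a distance-regular digraph if and only if $A^\top\in\{A_0,A_1,\ldots,A_D\}$ and, for each integer $\ell$ with $0\le\ell\le D$, the number of directed walks of length $\ell$ from $x$ to $y$ ($x,y\in X$) depends only on $h=\partial(x,y)$.
   Context: $\partial(x,y)$ is the directed distance; $\Gamma^{\rightarrow}_i(x)=\{z\mid\partial(x,z)=i\}$; $(A_i)_{xy}=1$ iff $\partial(x,y)=i$. $\Gamma$ is a distance-regular digraph if there are integers $d^{\rightarrow}_{ij},d^{\leftarrow}_{ij}$ $(0\le i,j\le D)$ such that for every $x\in X$ and every $y\in\Gamma^{\rightarrow}_i(x)$: $|\Gamma^{\rightarrow}_1(y)\cap\Gamma^{\rightarrow}_j(x)|=d^{\rightarrow}_{ij}$ and $|\Gamma^{\leftarrow}_1(y)\cap\Gamma^{\rightarrow}_j(x)|=d^{\leftarrow}_{ij}$. *)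

theory Defs
  imports "Graph_Theory.Graph_Theory"
begin

text \<open>
  A finite simple digraph is an instance of the locale \<^locale>\<open>digraph\<close> (finite, no loops, no
  parallel arcs), with vertex set \<open>verts G\<close>. Directed walks are the arc lists accepted by
  \<open>awalk\<close>; without parallel arcs these correspond to the vertex sequences of walks.
\<close>

text \<open>Unspecified unless \<open>y\<close> is reachable from \<open>x\<close>.\<close>

definition ddist :: "('a, 'b) pre_digraph \<Rightarrow> 'a \<Rightarrow> 'a \<Rightarrow> nat" where
  "ddist G x y = (LEAST n. \<exists>p. pre_digraph.awalk G x p y \<and> length p = n)"

lemma (in wf_digraph) mu_eq_ddist:
  assumes "u \<rightarrow>\<^sup>* v"
  shows "\<mu> (\<lambda>_. 1) u v = ereal (real (ddist G u v))"
proof -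
  have cost: "awalk_cost (\<lambda>_. 1) p = real (length p)" for p :: "'b list"
    by (induct p) auto
  obtain q where "awalk u q v"
    using assms by (auto simp: reachable_awalk)
  then have "\<exists>p. awalk u p v \<and> length p = length q"
    by blast
  then have "\<exists>p. awalk u p v \<and> length p = ddist G u v"
    unfolding ddist_def by (rule LeastI)
  then obtain p where p: "awalk u p v" "length p = ddist G u v"
    by blast
  have le: "ddist G u v \<le> length q" if "awalk u q v" for q
    unfolding ddist_def using that by (intro Least_le) blast
  show ?thesis
  proof (rule antisym)
    show "\<mu> (\<lambda>_. 1) u v \<le> ereal (real (ddist G u v))"
      using min_cost_le_walk_cost[OF p(1), of "\<lambda>_. 1"] p(2) by (simp add: cost)
    show "ereal (real (ddist G u v)) \<le> \<mu> (\<lambda>_. 1) u v"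
      unfolding \<mu>_def using le by (auto intro!: INF_greatest simp: cost)
  qed
qed

definition diam :: "('a, 'b) pre_digraph \<Rightarrow> nat" where
  "diam G = Max {ddist G x y | x y. x \<in> verts G \<and> y \<in> verts G}"

definition out_sphere :: "('a, 'b) pre_digraph \<Rightarrow> nat \<Rightarrow> 'a \<Rightarrow> 'a set" where
  "out_sphere G i x = {z \<in> verts G. ddist G x z = i}"

definition in_sphere :: "('a, 'b) pre_digraph \<Rightarrow> nat \<Rightarrow> 'a \<Rightarrow> 'a set" where
  "in_sphere G i x = {z \<in> verts G. ddist G z x = i}"

definition distance_regular :: "('a, 'b) pre_digraph \<Rightarrow> bool" where
  "distance_regular G \<longleftrightarrow>
     (\<exists>d_out d_in :: nat \<Rightarrow> nat \<Rightarrow> int.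
        \<forall>i \<le> diam G. \<forall>j \<le> diam G. \<forall>x \<in> verts G. \<forall>y \<in> out_sphere G i x.
          int (card (out_sphere G 1 y \<inter> out_sphere G j x)) = d_out i j \<and>
          int (card (in_sphere G 1 y \<inter> out_sphere G j x)) = d_in i j)"

text \<open>
  Matrices with rows and columns indexed by \<open>verts G\<close> are functions of two vertices that are
  zero outside \<open>verts G \<times> verts G\<close>, so that equality of functions is equality of matrices.
\<close>

definition adjacency_matrix :: "('a, 'b) pre_digraph \<Rightarrow> 'a \<Rightarrow> 'a \<Rightarrow> int" where
  "adjacency_matrix G x y = (if x \<in> verts G \<and> y \<in> verts G \<and> x \<rightarrow>\<^bsub>G\<^esub> y then 1 else 0)"

definition distance_matrix :: "('a, 'b) pre_digraph \<Rightarrow> nat \<Rightarrow> 'a \<Rightarrow> 'a \<Rightarrow> int" where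
  "distance_matrix G i x y =
     (if x \<in> verts G \<and> y \<in> verts G \<and> ddist G x y = i then 1 else 0)"

definition mtranspose :: "('a \<Rightarrow> 'a \<Rightarrow> int) \<Rightarrow> 'a \<Rightarrow> 'a \<Rightarrow> int" where
  "mtranspose M x y = M y x"

definition num_walks :: "('a, 'b) pre_digraph \<Rightarrow> nat \<Rightarrow> 'a \<Rightarrow> 'a \<Rightarrow> nat" where
  "num_walks G l x y = card {p. pre_digraph.awalk G x p y \<and> length p = l}"

end

theory Submission
  imports Defs
begin

text \<open>
  Let \<open>V\<close> be the span of the distance matrices \<open>A\<^sub>0, \<dots>, A\<^sub>D\<close>. Distance-regularity says that \<open>V\<close> is
  closed under right multiplication by \<open>A\<close> and by the transpose of \<open>A\<close>. Then \<open>V\<close> contains all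
  powers of \<open>A\<close> and of its transpose, so the numbers of walks of length \<open>l\<close> from \<open>x\<close> to \<open>y\<close> and from
  \<open>y\<close> to \<open>x\<close> depend only on \<open>\<partial>(x,y)\<close>. The least \<open>l\<close> for which the latter is positive is \<open>\<partial>(y,x)\<close>;
  so \<open>\<partial>(x,y)\<close> determines \<open>\<partial>(y,x)\<close>.

  Conversely, the powers \<open>A\<^sup>l\<close>, \<open>l \<le> D\<close>, are in \<open>V\<close> and triangular with respect to the \<open>A\<^sub>j\<close>, so \<open>A\<^sub>j\<close>
  is a polynomial of degree at most \<open>j\<close> in \<open>A\<close>. Hence the all-ones matrix is a polynomial in \<open>A\<close>
  and commutes with \<open>A\<close>, which makes the digraph regular. Therefore \<open>V\<close> is closed under right
  multiplication by \<open>A\<close>: this is clear for \<open>A\<^sub>j\<close> with \<open>j < D\<close>, and regularity deals with the sum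
  of all \<open>A\<^sub>j\<close>. Finally the transpose of \<open>A\<close>, being some \<open>A\<^sub>i\<close>, is a polynomial in \<open>A\<close>.
\<close>

section \<open>Matrices over the vertices and their spans\<close>

locale strong_digraph = digraph +
  assumes strong: "strongly_connected G"
begin

abbreviation dist_ind :: "nat \<Rightarrow> 'a \<Rightarrow> 'a \<Rightarrow> real" where
  "dist_ind j x y \<equiv> of_bool (ddist G x y = j)"

abbreviation walks :: "nat \<Rightarrow> 'a \<Rightarrow> 'a \<Rightarrow> real" where
  "walks l x y \<equiv> real (num_walks G l x y)"

definition mprod :: "('a \<Rightarrow> 'a \<Rightarrow> real) \<Rightarrow> ('a \<Rightarrow> 'a \<Rightarrow> real) \<Rightarrow> 'a \<Rightarrow> 'a \<Rightarrow> real" where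
  "mprod F H x y = (\<Sum>z\<in>verts G. F x z * H z y)"

text \<open>Membership in \<open>V\<close>: the values of \<open>f\<close> at 0, ..., D are the
  coefficients of the \<open>A\<^sub>j\<close>. Entries are compared at vertices only, so
  \<open>dist_ind\<close> needs no cut-off outside \<open>verts G\<close>.\<close>

definition dist_determined :: "('a \<Rightarrow> 'a \<Rightarrow> real) \<Rightarrow> bool" where
  "dist_determined F \<longleftrightarrow> (\<exists>f. \<forall>x\<in>verts G. \<forall>y\<in>verts G. F x y = f (ddist G x y))"

text \<open>Polynomials in \<open>A\<close> of degree at most \<open>m\<close>, as
  \<open>walks l\<close> is \<open>A\<^sup>l\<close>. Real coefficients allow the division in
  \<open>walk_span_dist_ind\<close>.\<close>

definition walk_span :: "nat \<Rightarrow> ('a \<Rightarrow> 'a \<Rightarrow> real) \<Rightarrow> bool" where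
  "walk_span m F \<longleftrightarrow>
     (\<exists>c. \<forall>x\<in>verts G. \<forall>y\<in>verts G. F x y = (\<Sum>l\<le>m. c l * walks l x y))"

section \<open>Walks and distance\<close>

lemma finite_walks: "finite {p. awalk x p y \<and> length p = l}"
  by (rule finite_subset[OF _ finite_lists_length_eq[OF finite_arcs, of l]])
    (auto simp: awalk_def)

lemma num_walks_pos_iff: "num_walks G l x y > 0 \<longleftrightarrow> (\<exists>p. awalk x p y \<and> length p = l)"
  unfolding num_walks_def using finite_walks[of x y l] by (auto simp: card_gt_0_iff)

text \<open>Makes the distance readable from walk counts alone; for the pair \<open>(y, x)\<close>
  this later recovers the reverse distance.\<close>

lemma ddist_eq_Least: "ddist G x y = (LEAST l. num_walks G l x y > 0)"
  by (simp add: ddist_def num_walks_pos_iff)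

lemma num_walks_ddist_pos:
  assumes "x \<in> verts G" "y \<in> verts G"
  shows "num_walks G (ddist G x y) x y > 0"
proof -
  obtain p where "awalk x p y"
    using strong assms by (auto simp: strongly_connected_def reachable_awalk)
  then have "num_walks G (length p) x y > 0"
    by (auto simp: num_walks_pos_iff)
  then show ?thesis
    unfolding ddist_eq_Least by (rule LeastI)
qed

lemma num_walks_eq_0: "l < ddist G x y \<Longrightarrow> num_walks G l x y = 0"
  using not_less_Least unfolding ddist_eq_Least by blast

lemma num_walks_0: "x \<in> verts G \<Longrightarrow> num_walks G 0 x y = of_bool (x = y)"
proof -
  assume "x \<in> verts G"
  then have "{p. awalk x p y \<and> length p = 0} = (if x = y then {[]} else {})"
    by (auto simp: awalk_Nil_iff)
  then show ?thesis
    by (simp add: num_walks_def)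
qed

lemma ddist_eq_0_iff:
  assumes "x \<in> verts G" "y \<in> verts G"
  shows "ddist G x y = 0 \<longleftrightarrow> x = y"
  using num_walks_ddist_pos[OF assms] num_walks_eq_0[of 0 x y] num_walks_0[OF assms(1), of y]
  by (cases "ddist G x y = 0") auto

lemma ddist_eq_1_iff:
  assumes "x \<in> verts G" "y \<in> verts G"
  shows "ddist G x y = 1 \<longleftrightarrow> x \<rightarrow> y"
proof
  assume d: "ddist G x y = 1"
  then obtain p where "awalk x p y" "length p = 1"
    using num_walks_ddist_pos[OF assms] unfolding num_walks_pos_iff by metis
  then show "x \<rightarrow> y"
    by (auto simp: length_Suc_conv awalk_Cons_iff awalk_Nil_iff intro!: in_arcs_imp_in_arcs_ends)
next
  assume "x \<rightarrow> y"
  then obtain e where e: "e \<in> arcs G" "tail G e = x" "head G e = y"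
    by auto
  then have "awalk x [e] y"
    by (auto simp: arc_implies_awalk)
  then have "num_walks G 1 x y > 0"
    unfolding num_walks_pos_iff by (intro exI[of _ "[e]"]) simp
  then have "ddist G x y \<le> 1"
    using num_walks_eq_0[of 1 x y] by (cases "1 < ddist G x y") auto
  moreover have "x \<noteq> y"
    using e no_loops[of e] by simp
  then have "ddist G x y \<noteq> 0"
    using ddist_eq_0_iff[OF assms] by simp
  ultimately show "ddist G x y = 1"
    by simp
qed

text \<open>Without parallel arcs an arc is fixed by its ends, so counting arc lists amounts to
  taking powers of a 0-1 matrix.\<close>

lemma card_arcs_between:
  assumes "x \<in> verts G" "y \<in> verts G"
  shows "card {e \<in> arcs G. tail G e = x \<and> head G e = y} = of_bool (ddist G x y = 1)"
proof (cases "x \<rightarrow> y")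
  case True
  then obtain e where e: "e \<in> arcs G" "tail G e = x" "head G e = y"
    by auto
  then have "{e \<in> arcs G. tail G e = x \<and> head G e = y} = {e}"
    using no_multi_arcs by (auto simp: arc_to_ends_def)
  then show ?thesis
    using True ddist_eq_1_iff[OF assms] by simp
next
  case False
  then have "{e \<in> arcs G. tail G e = x \<and> head G e = y} = {}"
    by (auto dest: in_arcs_imp_in_arcs_ends)
  then show ?thesis
    using False ddist_eq_1_iff[OF assms] by simp
qed

section \<open>Walk counts as powers of the adjacency matrix\<close>

lemma num_walks_Suc:
  assumes x: "x \<in> verts G"
  shows "num_walks G (Suc l) x y = (\<Sum>z\<in>verts G. of_bool (ddist G x z = 1) * num_walks G l z y)"
proof -
  let ?E = "\<lambda>z. {e \<in> arcs G. tail G e = x \<and> head G e = z}"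
  let ?Q = "\<lambda>z. {p. awalk z p y \<and> length p = l}"
  let ?S = "SIGMA z:verts G. ?E z \<times> ?Q z"
  \<comment> \<open>A walk of length \<open>l + 1\<close> splits into its second vertex
    \<open>z\<close>, its first arc \<open>e\<close> and the remaining walk \<open>q\<close> from
    \<open>z\<close>.\<close>
  have "{p. awalk x p y \<and> length p = Suc l} = (\<lambda>(z, e, q). e # q) ` ?S"
  proof (rule set_eqI)
    fix p
    show "p \<in> {p. awalk x p y \<and> length p = Suc l} \<longleftrightarrow> p \<in> (\<lambda>(z, e, q). e # q) ` ?S"
      by (cases p) (force simp: awalk_Cons_iff image_iff)+
  qed
  \<comment> \<open>\<open>e # q\<close> does not record \<open>z\<close>, but \<open>z\<close> is
    the head of \<open>e\<close>.\<close>
  moreover have "inj_on (\<lambda>(z, e, q). e # q) ?S"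
    by (auto simp: inj_on_def)
  ultimately have "num_walks G (Suc l) x y = card ?S"
    by (simp add: num_walks_def card_image)
  also have "\<dots> = (\<Sum>z\<in>verts G. card (?E z \<times> ?Q z))"
    using finite_walks by (intro card_SigmaI) auto
  also have "\<dots> = (\<Sum>z\<in>verts G. of_bool (ddist G x z = 1) * num_walks G l z y)"
    using card_arcs_between[OF x] by (simp add: card_cartesian_product num_walks_def)
  finally show ?thesis .
qed

lemma walks_Suc:
  assumes "x \<in> verts G"
  shows "walks (Suc l) x y = mprod (dist_ind 1) (walks l) x y"
  using num_walks_Suc[OF assms, of l y] by (simp add: mprod_def)

lemma mprod_assoc: "mprod (mprod F H) K x y = mprod F (mprod H K) x y"
  unfolding mprod_def sum_distrib_left sum_distrib_right
  by (subst sum.swap) (simp add: mult.assoc)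

lemma mprod_cong:
  assumes "\<And>z. z \<in> verts G \<Longrightarrow> F x z = F' x z" "\<And>z. z \<in> verts G \<Longrightarrow> H z y = H' z y"
  shows "mprod F H x y = mprod F' H' x y"
  unfolding mprod_def using assms by simp

lemma mprod_sum_left:
  "mprod (\<lambda>x y. \<Sum>i\<in>I. c i * F i x y) H x y = (\<Sum>i\<in>I. c i * mprod (F i) H x y)"
  unfolding mprod_def sum_distrib_left sum_distrib_right
  by (subst sum.swap) (simp add: mult.assoc)

lemma mprod_sum_right:
  "mprod F (\<lambda>x y. \<Sum>i\<in>I. c i * H i x y) x y = (\<Sum>i\<in>I. c i * mprod F (H i) x y)"
  unfolding mprod_def sum_distrib_left
  by (subst sum.swap) (simp add: mult.left_commute)

lemma mprod_walks_0:
  assumes "y \<in> verts G"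
  shows "mprod F (walks 0) x y = F x y"
proof -
  have "mprod F (walks 0) x y = (\<Sum>z\<in>verts G. if z = y then F x z else 0)"
    unfolding mprod_def by (intro sum.cong) (auto simp: num_walks_0)
  then show ?thesis
    using assms by simp
qed

lemma walks_1:
  assumes "x \<in> verts G" "y \<in> verts G"
  shows "walks (Suc 0) x y = dist_ind 1 x y"
  using walks_Suc[OF assms(1), of 0 y] mprod_walks_0[OF assms(2)] by simp

text \<open>The recursion at the last arc: peel off the first arc, use the induction hypothesis on
  the rest and reassociate.\<close>

lemma walks_Suc':
  assumes "x \<in> verts G" "y \<in> verts G"
  shows "walks (Suc l) x y = mprod (walks l) (dist_ind 1) x y"
  using assms
proof (induction l arbitrary: x)
  case 0
  have "mprod (walks 0) (dist_ind 1) x y = (\<Sum>z\<in>verts G. if z = x then dist_ind 1 z y else 0)"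
    unfolding mprod_def using 0 by (intro sum.cong) (auto simp: num_walks_0)
  then show ?case
    using 0 walks_1 by simp
next
  case (Suc l)
  have "walks (Suc (Suc l)) x y = mprod (dist_ind 1) (walks (Suc l)) x y"
    using Suc.prems by (intro walks_Suc)
  also have "\<dots> = mprod (dist_ind 1) (mprod (walks l) (dist_ind 1)) x y"
    using Suc by (intro mprod_cong) auto
  also have "\<dots> = mprod (mprod (dist_ind 1) (walks l)) (dist_ind 1) x y"
    by (simp add: mprod_assoc)
  also have "\<dots> = mprod (walks (Suc l)) (dist_ind 1) x y"
    using Suc.prems walks_Suc by (intro mprod_cong) auto
  finally show ?case .
qed

section \<open>The span of the distance matrices\<close>

lemma ddist_le_diam:
  assumes "x \<in> verts G" "y \<in> verts G"
  shows "ddist G x y \<le> diam G"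
proof -
  have "{ddist G x y | x y. x \<in> verts G \<and> y \<in> verts G} = case_prod (ddist G) ` (verts G \<times> verts G)"
    by auto
  then show ?thesis
    unfolding diam_def using assms by (intro Max_ge) auto
qed

text \<open>Only the summand at \<open>j = ddist G x y\<close> survives. With \<open>f\<close>
  constantly 1, the all-ones matrix is the sum of the \<open>A\<^sub>j\<close>.\<close>

lemma dist_ind_expansion:
  assumes "x \<in> verts G" "y \<in> verts G"
  shows "(\<Sum>j\<le>diam G. f j * dist_ind j x y) = f (ddist G x y)"
proof -
  have "(\<Sum>j\<le>diam G. f j * dist_ind j x y) = (\<Sum>j\<le>diam G. if j = ddist G x y then f j else 0)"
    by (intro sum.cong) auto
  then show ?thesis
    using ddist_le_diam[OF assms] by simp
qed

lemma dist_determined_cong: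
  assumes "dist_determined H"
    and "\<And>x y. x \<in> verts G \<Longrightarrow> y \<in> verts G \<Longrightarrow> F x y = H x y"
  shows "dist_determined F"
  using assms unfolding dist_determined_def by simp

lemma dist_determined_sum:
  assumes "\<And>i. i \<in> I \<Longrightarrow> dist_determined (F i)"
  shows "dist_determined (\<lambda>x y. \<Sum>i\<in>I. c i * F i x y)"
proof -
  obtain f where "\<forall>i\<in>I. \<forall>x\<in>verts G. \<forall>y\<in>verts G. F i x y = f i (ddist G x y)"
    using assms unfolding dist_determined_def by metis
  then show ?thesis
    unfolding dist_determined_def
    by (intro exI[of _ "\<lambda>d. \<Sum>i\<in>I. c i * f i d"]) simp
qed

text \<open>By linearity in the left factor it is enough to test the spanning matrices
  \<open>A\<^sub>j\<close>.\<close>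

lemma dist_determined_mprod:
  assumes "\<And>j. j \<le> diam G \<Longrightarrow> dist_determined (mprod (dist_ind j) M)" "dist_determined F"
  shows "dist_determined (mprod F M)"
proof -
  obtain f where f: "\<forall>x\<in>verts G. \<forall>y\<in>verts G. F x y = f (ddist G x y)"
    using assms(2) unfolding dist_determined_def by blast
  have eq: "mprod F M x y = (\<Sum>j\<le>diam G. f j * mprod (dist_ind j) M x y)"
    if "x \<in> verts G" "y \<in> verts G" for x y
  proof -
    have "mprod F M x y = mprod (\<lambda>x z. \<Sum>j\<le>diam G. f j * dist_ind j x z) M x y"
      using that f by (intro mprod_cong) (subst dist_ind_expansion, simp_all)
    then show ?thesis
      by (simp only: mprod_sum_left)
  qed
  show ?thesis
    by (rule dist_determined_cong[OF dist_determined_sum eq]) (use assms(1) in auto)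
qed

section \<open>Distance-regularity as closure under multiplication\<close>

text \<open>The entry at \<open>(x, y)\<close> of \<open>A\<^sub>j\<close> times \<open>A\<close>
  counts the in-neighbours of \<open>y\<close> at distance \<open>j\<close> from \<open>x\<close>;
  with the transpose of \<open>A\<close> it counts the out-neighbours.\<close>

lemma distance_regular_iff:
  "distance_regular G \<longleftrightarrow>
     (\<forall>j\<le>diam G. dist_determined (mprod (dist_ind j) (dist_ind 1)) \<and>
                 dist_determined (mprod (dist_ind j) (\<lambda>x y. dist_ind 1 y x)))"
proof -
  have i: "mprod (dist_ind j) (dist_ind 1) x y = card (in_sphere G 1 y \<inter> out_sphere G j x)" for j x y
  proof -
    have "in_sphere G 1 y \<inter> out_sphere G j x
        = verts G \<inter> {z. ddist G x z = j \<and> ddist G z y = 1}"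
      by (auto simp: in_sphere_def out_sphere_def)
    then show ?thesis
      by (simp add: mprod_def flip: of_bool_conj)
  qed
  have o: "mprod (dist_ind j) (\<lambda>x y. dist_ind 1 y x) x y
      = card (out_sphere G 1 y \<inter> out_sphere G j x)" for j x y
  proof -
    have "out_sphere G 1 y \<inter> out_sphere G j x
        = verts G \<inter> {z. ddist G x z = j \<and> ddist G y z = 1}"
      by (auto simp: out_sphere_def)
    then show ?thesis
      by (simp add: mprod_def flip: of_bool_conj)
  qed
  show ?thesis
  proof
    assume "distance_regular G"
    then obtain d_out d_in :: "nat \<Rightarrow> nat \<Rightarrow> int" where
      d: "\<forall>i \<le> diam G. \<forall>j \<le> diam G. \<forall>x \<in> verts G. \<forall>y \<in> out_sphere G i x.
          int (card (out_sphere G 1 y \<inter> out_sphere G j x)) = d_out i j \<and>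
          int (card (in_sphere G 1 y \<inter> out_sphere G j x)) = d_in i j"
      unfolding distance_regular_def by blast
    have d': "int (card (out_sphere G 1 y \<inter> out_sphere G j x)) = d_out (ddist G x y) j \<and>
          int (card (in_sphere G 1 y \<inter> out_sphere G j x)) = d_in (ddist G x y) j"
      if "j \<le> diam G" "x \<in> verts G" "y \<in> verts G" for x y j
      using d that ddist_le_diam[OF that(2,3)] by (auto simp: out_sphere_def)
    have "real (card (in_sphere G 1 y \<inter> out_sphere G j x)) = of_int (d_in (ddist G x y) j)"
      "real (card (out_sphere G 1 y \<inter> out_sphere G j x)) = of_int (d_out (ddist G x y) j)"
      if "j \<le> diam G" "x \<in> verts G" "y \<in> verts G" for x y j
      using d'[OF that] by (metis of_int_of_nat_eq)+
    then show "\<forall>j\<le>diam G. dist_determined (mprod (dist_ind j) (dist_ind 1)) \<and>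
                 dist_determined (mprod (dist_ind j) (\<lambda>x y. dist_ind 1 y x))"
      unfolding dist_determined_def i o by (intro allI impI conjI exI ballI) simp_all
  next
    assume *: "\<forall>j\<le>diam G. dist_determined (mprod (dist_ind j) (dist_ind 1)) \<and>
                 dist_determined (mprod (dist_ind j) (\<lambda>x y. dist_ind 1 y x))"
    then obtain f where f: "\<forall>j\<le>diam G. \<forall>x\<in>verts G. \<forall>y\<in>verts G.
        real (card (in_sphere G 1 y \<inter> out_sphere G j x)) = f j (ddist G x y)"
      unfolding dist_determined_def i o by metis
    obtain g where g: "\<forall>j\<le>diam G. \<forall>x\<in>verts G. \<forall>y\<in>verts G.
        real (card (out_sphere G 1 y \<inter> out_sphere G j x)) = g j (ddist G x y)"
      using * unfolding dist_determined_def i o by metis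
    \<comment> \<open>\<open>f\<close> and \<open>g\<close> are real-valued and known to be integral
      only at distances that occur; the floor keeps those values and is an integer
      everywhere.\<close>
    have d: "int (card (out_sphere G 1 y \<inter> out_sphere G j x)) = \<lfloor>g j i\<rfloor>"
      "int (card (in_sphere G 1 y \<inter> out_sphere G j x)) = \<lfloor>f j i\<rfloor>"
      if "j \<le> diam G" "x \<in> verts G" "y \<in> out_sphere G i x" for i j x y
    proof -
      have "y \<in> verts G" "ddist G x y = i"
        using that(3) by (simp_all add: out_sphere_def)
      then have "real (card (out_sphere G 1 y \<inter> out_sphere G j x)) = g j i"
        "real (card (in_sphere G 1 y \<inter> out_sphere G j x)) = f j i"
        using f g that(1,2) by blast+
      then show "int (card (out_sphere G 1 y \<inter> out_sphere G j x)) = \<lfloor>g j i\<rfloor>"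
        "int (card (in_sphere G 1 y \<inter> out_sphere G j x)) = \<lfloor>f j i\<rfloor>"
        by (metis floor_of_nat)+
    qed
    show "distance_regular G"
      unfolding distance_regular_def
      by (intro exI[of _ "\<lambda>i j. \<lfloor>g j i\<rfloor>"] exI[of _ "\<lambda>i j. \<lfloor>f j i\<rfloor>"] allI impI ballI conjI d)
  qed
qed

lemma transpose_adjacency_iff:
  "mtranspose (adjacency_matrix G) = distance_matrix G i \<longleftrightarrow>
     (\<forall>x\<in>verts G. \<forall>y\<in>verts G. ddist G y x = 1 \<longleftrightarrow> ddist G x y = i)"
  unfolding fun_eq_iff mtranspose_def adjacency_matrix_def distance_matrix_def
  by (auto simp: ddist_eq_1_iff[unfolded One_nat_def] split: if_splits)

text \<open>The diameter is attained, so some pair has positive distance; the first arc of a walk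
  between the two will do.\<close>

lemma exists_arc:
  assumes "diam G \<ge> 1"
  shows "\<exists>x\<in>verts G. \<exists>y\<in>verts G. ddist G x y = 1"
proof -
  let ?S = "{ddist G x y | x y. x \<in> verts G \<and> y \<in> verts G}"
  have "?S = case_prod (ddist G) ` (verts G \<times> verts G)"
    by auto
  moreover have "verts G \<noteq> {}"
    using strong by (auto simp: strongly_connected_def)
  ultimately have "Max ?S \<in> ?S"
    by (intro Max_in) auto
  then obtain x y where xy: "x \<in> verts G" "y \<in> verts G" "ddist G x y \<ge> 1"
    using assms unfolding diam_def by auto
  then obtain l where "ddist G x y = Suc l"
    by (cases "ddist G x y") auto
  then have "num_walks G (Suc l) x y > 0"
    using num_walks_ddist_pos[OF xy(1,2)] by simp
  then have "\<exists>z\<in>verts G. ddist G x z = 1"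
    unfolding num_walks_Suc[OF xy(1)] by (rule contrapos_pp) auto
  then show ?thesis
    using xy(1) by blast
qed

section \<open>Consequences of distance-regularity\<close>

text \<open>\<open>V\<close> contains the identity and is closed under both multiplications, so
  induction reaches every \<open>l\<close>, also beyond the diameter.\<close>

lemma distance_regular_imp_walks:
  assumes "distance_regular G"
  shows "dist_determined (walks l)" "dist_determined (\<lambda>x y. walks l y x)"
proof -
  have 0: "dist_determined (walks 0)" "dist_determined (\<lambda>x y. walks 0 y x)"
    unfolding dist_determined_def
    by (intro exI[of _ "\<lambda>d. of_bool (d = 0)"]; auto simp: num_walks_0 ddist_eq_0_iff)+
  show "dist_determined (walks l)"
  proof (induction l)
    case (Suc l)
    then have "dist_determined (mprod (walks l) (dist_ind 1))"
      using assms unfolding distance_regular_iff by - (rule dist_determined_mprod, auto)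
    then show ?case
      by (rule dist_determined_cong) (rule walks_Suc')
  qed (rule 0)
  show "dist_determined (\<lambda>x y. walks l y x)"
  proof (induction l)
    case (Suc l)
    then have "dist_determined (mprod (\<lambda>x y. walks l y x) (\<lambda>x y. dist_ind 1 y x))"
      using assms unfolding distance_regular_iff by - (rule dist_determined_mprod, auto)
    \<comment> \<open>The first arc of a walk from \<open>y\<close> to \<open>x\<close> supplies the
      last factor in the power of the transpose.\<close>
    moreover have "walks (Suc l) y x = mprod (\<lambda>x y. walks l y x) (\<lambda>x y. dist_ind 1 y x) x y"
      if "y \<in> verts G" for x y
      using walks_Suc[OF that] by (simp add: mprod_def mult.commute)
    ultimately show ?case
      by (rule dist_determined_cong)
  qed (rule 0)
qed

text \<open>The index is the distance back along an arc. In diameter 0 there is no arc: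
  \<open>A\<close> is zero but \<open>A\<^sub>0\<close> is the identity, so the claim would
  fail.\<close>

lemma distance_regular_imp_transpose:
  assumes dr: "distance_regular G" and "diam G \<ge> 1"
  shows "\<exists>i\<le>diam G. mtranspose (adjacency_matrix G) = distance_matrix G i"
proof -
  obtain b where b: "\<And>l x y. x \<in> verts G \<Longrightarrow> y \<in> verts G \<Longrightarrow> walks l y x = b l (ddist G x y)"
    using distance_regular_imp_walks(2)[OF dr] unfolding dist_determined_def by metis
  \<comment> \<open>For a distance \<open>d\<close> that occurs, \<open>f d\<close> is the least
    length of a walk back, hence the reverse distance.\<close>
  define f where "f d = (LEAST l. b l d > 0)" for d
  have f: "ddist G y x = f (ddist G x y)" if "x \<in> verts G" "y \<in> verts G" for x y
    unfolding ddist_eq_Least[of y x] f_def using b[OF that, symmetric] by simp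
  obtain x y where "x \<in> verts G" "y \<in> verts G" "ddist G x y = 1"
    using exists_arc[OF assms(2)] by blast
  \<comment> \<open>Reversing a pair twice restores it. Hence \<open>ddist G y x = 1\<close> exactly
    when \<open>ddist G x y = f 1\<close>, and \<open>f 1\<close> is the index sought.\<close>
  then have "f (f 1) = 1" "f 1 \<le> diam G"
    using f ddist_le_diam by metis+
  then show ?thesis
    unfolding transpose_adjacency_iff using f by metis
qed

section \<open>Polynomials in the adjacency matrix\<close>

lemma walk_span_sum:
  assumes "\<And>i. i \<in> I \<Longrightarrow> walk_span m (F i)"
  shows "walk_span m (\<lambda>x y. \<Sum>i\<in>I. c i * F i x y)"
proof -
  obtain a where a: "\<forall>i\<in>I. \<forall>x\<in>verts G. \<forall>y\<in>verts G. F i x y = (\<Sum>l\<le>m. a i l * walks l x y)"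
    using assms unfolding walk_span_def by metis
  have "(\<Sum>i\<in>I. c i * F i x y) = (\<Sum>l\<le>m. (\<Sum>i\<in>I. c i * a i l) * walks l x y)"
    if "x \<in> verts G" "y \<in> verts G" for x y
  proof -
    have "(\<Sum>i\<in>I. c i * F i x y) = (\<Sum>i\<in>I. \<Sum>l\<le>m. c i * (a i l * walks l x y))"
      using a that by (simp add: sum_distrib_left)
    then show ?thesis
      by (simp add: sum_distrib_right mult.assoc sum.swap[of _ I])
  qed
  then show ?thesis
    unfolding walk_span_def by (intro exI[of _ "\<lambda>l. \<Sum>i\<in>I. c i * a i l"]) simp
qed

lemma walk_span_walks:
  assumes "l \<le> m"
  shows "walk_span m (walks l)"
proof -
  have "(\<Sum>k\<le>m. of_bool (k = l) * walks k x y) = walks l x y" for x y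
  proof -
    have "(\<Sum>k\<le>m. of_bool (k = l) * walks k x y) = (\<Sum>k\<le>m. if k = l then walks k x y else 0)"
      by (intro sum.cong) auto
    then show ?thesis
      using assms by simp
  qed
  then show ?thesis
    unfolding walk_span_def by (intro exI[of _ "\<lambda>k. of_bool (k = l)"]) simp
qed

lemma walk_span_cong:
  assumes "walk_span m H"
    and "\<And>x y. x \<in> verts G \<Longrightarrow> y \<in> verts G \<Longrightarrow> F x y = H x y"
  shows "walk_span m F"
  using assms unfolding walk_span_def by simp

lemma walk_span_mono:
  assumes "walk_span m F" "m \<le> n"
  shows "walk_span n F"
proof -
  obtain c where c: "\<And>x y. x \<in> verts G \<Longrightarrow> y \<in> verts G \<Longrightarrow> F x y = (\<Sum>l\<le>m. c l * walks l x y)"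
    using assms(1) unfolding walk_span_def by blast
  show ?thesis
    by (rule walk_span_cong[OF walk_span_sum c]) (use walk_span_walks assms(2) in auto)
qed

text \<open>\<open>A\<close> commutes with its powers: \<open>walks (Suc l)\<close> arises both by
  prepending and by appending an arc.\<close>

lemma walk_span_commute:
  assumes "walk_span m F" "x \<in> verts G" "y \<in> verts G"
  shows "mprod F (dist_ind 1) x y = mprod (dist_ind 1) F x y"
proof -
  obtain c where c: "\<forall>x\<in>verts G. \<forall>y\<in>verts G. F x y = (\<Sum>l\<le>m. c l * walks l x y)"
    using assms(1) unfolding walk_span_def by blast
  have "mprod F (dist_ind 1) x y = mprod (\<lambda>x y. \<Sum>l\<le>m. c l * walks l x y) (dist_ind 1) x y"
    using c assms by (intro mprod_cong) auto
  also have "\<dots> = mprod (dist_ind 1) (\<lambda>x y. \<Sum>l\<le>m. c l * walks l x y) x y"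
    unfolding mprod_sum_left mprod_sum_right
    using assms(2,3) walks_Suc walks_Suc' by (intro sum.cong) auto
  also have "\<dots> = mprod (dist_ind 1) F x y"
    using c assms by (intro mprod_cong) auto
  finally show ?thesis .
qed

text \<open>The degree bound grows by one, which is why \<open>A\<^sub>D\<close> needs separate
  treatment in \<open>dist_determined_mprod_adj\<close>.\<close>

lemma walk_span_mprod:
  assumes "walk_span m F"
  shows "walk_span (Suc m) (mprod F (dist_ind 1))"
proof -
  obtain c where c: "\<forall>x\<in>verts G. \<forall>y\<in>verts G. F x y = (\<Sum>l\<le>m. c l * walks l x y)"
    using assms(1) unfolding walk_span_def by blast
  have eq: "mprod F (dist_ind 1) x y = (\<Sum>l\<le>m. c l * walks (Suc l) x y)"
    if "x \<in> verts G" "y \<in> verts G" for x y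
  proof -
    have "mprod F (dist_ind 1) x y = mprod (\<lambda>x y. \<Sum>l\<le>m. c l * walks l x y) (dist_ind 1) x y"
      using c that by (intro mprod_cong) auto
    also have "\<dots> = (\<Sum>l\<le>m. c l * walks (Suc l) x y)"
      unfolding mprod_sum_left using that walks_Suc' by (intro sum.cong) auto
    finally show ?thesis .
  qed
  show ?thesis
    by (rule walk_span_cong[OF walk_span_sum eq]) (use walk_span_walks in auto)
qed

section \<open>From walk counts back to distance-regularity\<close>

context
  assumes walks_det: "\<And>l. l \<le> diam G \<Longrightarrow> dist_determined (walks l)"
begin

lemma walk_span_dist_determined:
  assumes "walk_span m F" "m \<le> diam G"
  shows "dist_determined F"
proof -
  obtain c where c: "\<And>x y. x \<in> verts G \<Longrightarrow> y \<in> verts G \<Longrightarrow> F x y = (\<Sum>l\<le>m. c l * walks l x y)"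
    using assms(1) unfolding walk_span_def by blast
  show ?thesis
    by (rule dist_determined_cong[OF dist_determined_sum c]) (use walks_det assms(2) in auto)
qed

text \<open>Triangular inversion: \<open>A\<^sup>j\<close> is a combination of the
  \<open>A\<^sub>h\<close> with \<open>h \<le> j\<close>, and the coefficient of
  \<open>A\<^sub>j\<close> is nonzero. Solve for \<open>A\<^sub>j\<close> and use induction for
  \<open>h < j\<close>.\<close>

lemma walk_span_dist_ind:
  assumes "j \<le> diam G"
  shows "walk_span j (dist_ind j)"
  using assms
proof (induction j rule: less_induct)
  case (less j)
  obtain a where a: "\<And>x y. x \<in> verts G \<Longrightarrow> y \<in> verts G \<Longrightarrow> walks j x y = a (ddist G x y)"
    using walks_det[OF less.prems] unfolding dist_determined_def by blast
  show ?case
  proof (cases "\<exists>x\<in>verts G. \<exists>y\<in>verts G. ddist G x y = j")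
    case False
    then show ?thesis
      unfolding walk_span_def by (intro exI[of _ "\<lambda>_. 0"]) auto
  next
    case True
    then have "a j \<noteq> 0"
      using a num_walks_ddist_pos by (metis of_nat_0_eq_iff less_irrefl)
    \<comment> \<open>The solved equation as a single sum, with \<open>A\<^sup>j\<close> in the slot
      \<open>h = j\<close>.\<close>
    let ?F = "\<lambda>h. if h = j then walks j else dist_ind h"
    let ?c = "\<lambda>h. if h = j then 1 / a j else - a h / a j"
    have "dist_ind j x y = (\<Sum>h\<le>j. ?c h * ?F h x y)" if xy: "x \<in> verts G" "y \<in> verts G" for x y
    proof -
      have "(\<Sum>h<j. a h * dist_ind h x y) = (\<Sum>h<j. if h = ddist G x y then a h else 0)"
        by (intro sum.cong) auto
      also have "\<dots> = (if ddist G x y < j then a (ddist G x y) else 0)"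
        by simp
      \<comment> \<open>Beyond distance \<open>j\<close> both sides vanish, as there is no walk of
        length \<open>j\<close>; at distance \<open>j\<close> the two terms on the right
        cancel.\<close>
      also have "\<dots> = walks j x y - a j * dist_ind j x y"
        using a[OF xy] num_walks_eq_0[of j x y] by (cases "ddist G x y" j rule: linorder_cases) auto
      finally have "dist_ind j x y = walks j x y / a j - (\<Sum>h<j. a h * dist_ind h x y) / a j"
        using \<open>a j \<noteq> 0\<close> by (simp add: field_simps)
      also have "\<dots> = ?c j * ?F j x y + (\<Sum>h<j. ?c h * ?F h x y)"
        by (simp add: sum_divide_distrib sum_negf del: sum_mult_of_bool_eq)
      also have "\<dots> = (\<Sum>h\<le>j. ?c h * ?F h x y)"
        by (simp add: lessThan_Suc_atMost[symmetric])
      finally show ?thesis .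
    qed
    moreover have "walk_span j (\<lambda>x y. \<Sum>h\<le>j. ?c h * ?F h x y)"
    proof (rule walk_span_sum)
      fix h assume "h \<in> {..j}"
      then show "walk_span j (?F h)"
        using less.IH[of h] less.prems walk_span_mono[of h _ j] walk_span_walks[of j j]
        by (cases "h = j") auto
    qed
    ultimately show ?thesis
      by (rule walk_span_cong[rotated])
  qed
qed

text \<open>The all-ones matrix is a polynomial in \<open>A\<close>, so it commutes with
  \<open>A\<close>. At \<open>(x, y)\<close> the two products are the in-degree of \<open>y\<close>
  and the out-degree of \<open>x\<close>, so both are constant.\<close>

lemma in_degree_const:
  "\<exists>k. \<forall>y\<in>verts G. (\<Sum>z\<in>verts G. dist_ind 1 z y) = k"
proof -
  have "walk_span (diam G) (\<lambda>x y. \<Sum>j\<le>diam G. 1 * dist_ind j x y)"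
    using walk_span_dist_ind walk_span_mono by (intro walk_span_sum) auto
  then have "walk_span (diam G) (\<lambda>x y. 1)"
    by (rule walk_span_cong) (rule dist_ind_expansion[symmetric])
  from walk_span_commute[OF this]
  have "(\<Sum>z\<in>verts G. dist_ind 1 z y) = (\<Sum>z\<in>verts G. dist_ind 1 x z)"
    if "x \<in> verts G" "y \<in> verts G" for x y
    using that by (simp add: mprod_def)
  moreover obtain x where "x \<in> verts G"
    using strong by (auto simp: strongly_connected_def)
  ultimately show ?thesis
    by blast
qed

lemma dist_determined_mprod_adj:
  assumes "dist_determined F"
  shows "dist_determined (mprod F (dist_ind 1))"
proof (rule dist_determined_mprod[OF _ assms])
  fix j assume "j \<le> diam G"
  \<comment> \<open>Here the product has degree at most \<open>h + 1 \<le> diam G\<close>, within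
    the range of the assumption on walks.\<close>
  have less: "dist_determined (mprod (dist_ind h) (dist_ind 1))" if "h < diam G" for h
    using that walk_span_dist_determined[OF walk_span_mprod[OF walk_span_dist_ind]] by simp
  show "dist_determined (mprod (dist_ind j) (dist_ind 1))"
  proof (cases "j = diam G")
    case False
    then show ?thesis
      using less \<open>j \<le> diam G\<close> by simp
  next
    case True
    obtain k where k: "\<forall>y\<in>verts G. (\<Sum>z\<in>verts G. dist_ind 1 z y) = k"
      using in_degree_const by blast
    obtain s where s: "\<forall>x\<in>verts G. \<forall>y\<in>verts G.
        (\<Sum>h<diam G. 1 * mprod (dist_ind h) (dist_ind 1) x y) = s (ddist G x y)"
      using dist_determined_sum[of "{..<diam G}" "\<lambda>h. mprod (dist_ind h) (dist_ind 1)" "\<lambda>_. 1"] less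
      unfolding dist_determined_def by auto
    \<comment> \<open>All columns of \<open>A\<close> sum to \<open>k\<close>, so the products of
      all \<open>A\<^sub>h\<close> with \<open>A\<close> add up to \<open>k\<close> in each entry;
      subtract those with \<open>h < diam G\<close>.\<close>
    have "mprod (dist_ind j) (dist_ind 1) x y = k - s (ddist G x y)"
      if xy: "x \<in> verts G" "y \<in> verts G" for x y
    proof -
      have "k = mprod (\<lambda>_ _. 1) (dist_ind 1) x y"
        using k xy by (simp add: mprod_def)
      also have "\<dots> = mprod (\<lambda>x y. \<Sum>h\<le>diam G. 1 * dist_ind h x y) (dist_ind 1) x y"
        using dist_ind_expansion[of _ _ "\<lambda>_. 1"] xy by (intro mprod_cong) auto
      also have "\<dots> = (\<Sum>h\<le>diam G. 1 * mprod (dist_ind h) (dist_ind 1) x y)"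
        by (rule mprod_sum_left)
      also have "\<dots> = s (ddist G x y) + mprod (dist_ind j) (dist_ind 1) x y"
        using s xy True by (simp add: lessThan_Suc_atMost[symmetric])
      finally show ?thesis
        by simp
    qed
    then show ?thesis
      unfolding dist_determined_def by (intro exI[of _ "\<lambda>d. k - s d"]) simp
  qed
qed

lemma dist_determined_mprod_walks:
  assumes "dist_determined F"
  shows "dist_determined (mprod F (walks l))"
proof (induction l)
  case 0
  show ?case
    using assms by (rule dist_determined_cong) (rule mprod_walks_0)
next
  case (Suc l)
  have "mprod F (walks (Suc l)) x y = mprod (mprod F (walks l)) (dist_ind 1) x y"
    if "x \<in> verts G" "y \<in> verts G" for x y
    unfolding mprod_assoc using that(2) by (intro mprod_cong refl walks_Suc')
  with dist_determined_mprod_adj[OF Suc] show ?case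
    by (rule dist_determined_cong)
qed

text \<open>\<open>V\<close> is closed under right multiplication by \<open>A\<close>, hence by
  every polynomial in \<open>A\<close>; \<open>m\<close> may exceed the diameter.\<close>

lemma dist_determined_mprod_walk_span:
  assumes "dist_determined F" "walk_span m H"
  shows "dist_determined (mprod F H)"
proof -
  obtain c where c: "\<forall>x\<in>verts G. \<forall>y\<in>verts G. H x y = (\<Sum>l\<le>m. c l * walks l x y)"
    using assms(2) unfolding walk_span_def by blast
  have "mprod F H x y = (\<Sum>l\<le>m. c l * mprod F (walks l) x y)"
    if "x \<in> verts G" "y \<in> verts G" for x y
  proof -
    have "mprod F H x y = mprod F (\<lambda>x y. \<Sum>l\<le>m. c l * walks l x y) x y"
      using c that by (intro mprod_cong) auto
    then show ?thesis
      by (simp only: mprod_sum_right)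
  qed
  moreover have "dist_determined (\<lambda>x y. \<Sum>l\<le>m. c l * mprod F (walks l) x y)"
    using assms(1) by (intro dist_determined_sum dist_determined_mprod_walks)
  ultimately show ?thesis
    by (rule dist_determined_cong[rotated])
qed

text \<open>The transpose of \<open>A\<close> is \<open>A\<^sub>i\<close>, a polynomial in
  \<open>A\<close>, so closure under \<open>A\<close> gives closure under the transpose.\<close>

lemma distance_regularI:
  assumes "i \<le> diam G" "mtranspose (adjacency_matrix G) = distance_matrix G i"
  shows "distance_regular G"
proof -
  have tr: "dist_ind 1 y x = dist_ind i x y" if "x \<in> verts G" "y \<in> verts G" for x y
    using assms(2) that unfolding transpose_adjacency_iff by simp
  have det: "dist_determined (dist_ind j)" for j
    unfolding dist_determined_def by (intro exI[of _ "\<lambda>d. of_bool (d = j)"]) simp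
  have "dist_determined (mprod (dist_ind j) (\<lambda>x y. dist_ind 1 y x))" for j
  proof -
    have "dist_determined (mprod (dist_ind j) (dist_ind i))"
      using det walk_span_dist_ind[OF assms(1)] by (rule dist_determined_mprod_walk_span)
    moreover have "mprod (dist_ind j) (\<lambda>x y. dist_ind 1 y x) x y
        = mprod (dist_ind j) (dist_ind i) x y" if "x \<in> verts G" "y \<in> verts G" for x y
      using that tr by (intro mprod_cong) auto
    ultimately show ?thesis
      by (rule dist_determined_cong)
  qed
  then show ?thesis
    unfolding distance_regular_iff using det dist_determined_mprod_adj by blast
qed

end

section \<open>Natural-number walk counts and the equivalence\<close>

lemma dist_determined_walks_iff:
  "dist_determined (walks l) \<longleftrightarrow>
     (\<exists>a :: nat \<Rightarrow> nat. \<forall>x\<in>verts G. \<forall>y\<in>verts G. num_walks G l x y = a (ddist G x y))"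
proof
  assume "dist_determined (walks l)"
  then obtain f where "\<forall>x\<in>verts G. \<forall>y\<in>verts G. walks l x y = f (ddist G x y)"
    unfolding dist_determined_def by blast
  then have "\<forall>x\<in>verts G. \<forall>y\<in>verts G. num_walks G l x y = nat \<lfloor>f (ddist G x y)\<rfloor>"
    by (metis floor_of_nat nat_int)
  then show "\<exists>a :: nat \<Rightarrow> nat. \<forall>x\<in>verts G. \<forall>y\<in>verts G. num_walks G l x y = a (ddist G x y)"
    by (intro exI[of _ "\<lambda>d. nat \<lfloor>f d\<rfloor>"]) simp
next
  assume "\<exists>a :: nat \<Rightarrow> nat. \<forall>x\<in>verts G. \<forall>y\<in>verts G. num_walks G l x y = a (ddist G x y)"
  then obtain a :: "nat \<Rightarrow> nat" where "\<forall>x\<in>verts G. \<forall>y\<in>verts G. num_walks G l x y = a (ddist G x y)"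
    by blast
  then show "dist_determined (walks l)"
    unfolding dist_determined_def by (intro exI[of _ "\<lambda>d. real (a d)"]) simp
qed

end

theorem theorem8p1:
  fixes G :: "('a, 'b) pre_digraph"
  assumes "digraph G"
    and "strongly_connected G"
    and "diam G \<ge> 1"
  shows "distance_regular G \<longleftrightarrow>
    mtranspose (adjacency_matrix G) \<in> {distance_matrix G i | i. i \<le> diam G} \<and>
    (\<forall>l \<le> diam G. \<exists>a :: nat \<Rightarrow> nat. \<forall>x \<in> verts G. \<forall>y \<in> verts G.
        num_walks G l x y = a (ddist G x y))"
proof -
  interpret strong_digraph G
    using assms by (simp add: strong_digraph_def strong_digraph_axioms_def)
  show ?thesis
    unfolding dist_determined_walks_iff[symmetric]
    using distance_regular_imp_walks(1) distance_regular_imp_transpose[OF _ assms(3)]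
      distance_regularI by blast
qed

end
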